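(* Assume that the triangulation $\mathcal{P}=\bigcup_{s\in[q]}P_s$ is separating for problem (C). Let $(\lambda^j)_{j\in[k]}$ be an optimal solution of problem (R1) (i.e. $\lambda^j\in\Delta^m_\Omega$ for all $j$, and together with some assignment matrix $U$ they are optimal for (R1)) whose points $x_j=V\lambda^j$, $j\in[k]$, are separated by $\mathcal{P}$. Put $$\lambda_*:=\sum_{j\in[k]}\lambda^j .$$ Then for every $\lambda\in\Delta^m_\Omega$, $$\lambda\in\{\lambda^j\}_{j\in[k]}\quad\Longleftrightarrow\quad \lambda\le\lambda_*,$$ where $\le$ denotes the coordinatewise order on $\mathbb{R}^m$.
   Context: Notation: $[n]=\{1,\dots,n\}$; $e$ is the all-ones vector of appropriate dimension; $I_r$ and $J_r$ are the $r\times r$ identity and all-ones matrices; $\langle\cdot,\cdot\rangle$ is the standard inner product; $\Delta^m=\{\lambda\in\mathbb{R}^m:\lambda\ge 0,\ \langle\lambda,e\rangle=1\}$. Problem (C): given positive integers $n,k,d,l$ and data $A_i\in\mathbb{R}^{l\times d}$, $b_i\in\mathbb{R}^l$ ($i\in[n]$), minimize $\sum_{i\in[n]}\sum_{j\in[k]}u_{ij}\|A_ix_j-b_i\|_2^2$ over $x_1,\dots,x_k\in\mathbb{R}^d$ and $U=(u_{ij})\in\{0,1\}^{n\times k}$ with $Ue=e$. The points $x_1,\dots,x_k$ are an optimal set of centroids if together with some such $U$ they form an optimal solution. Triangulation: $\mathcal{P}=\bigcup_{s\in[q]}P_s\subseteq\mathbb{R}^d$, where $P_1,\dots,P_q$ are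 $d$-dimensional simplices with pairwise disjoint interiors; it is assumed that $\{x_j\}_{j\in[k]}\subseteq\mathcal{P}$ is a valid constraint for (C), i.e. an optimal set of centroids is contained in $\mathcal{P}$. Let $V_s\in\mathbb{R}^{d\times(d+1)}$ be the matrix whose columns are the vertices of $P_s$, $m=q(d+1)$, and $V=(V_1,\dots,V_q)\in\mathbb{R}^{d\times m}$ (columns may repeat for different $s$). The coordinates of $\lambda\in\mathbb{R}^m$ are correspondingly split into $q$ consecutive blocks $\lambda_{v(1)},\dots,\lambda_{v(q)}\in\mathbb{R}^{d+1}$, so $V\lambda=\sum_{s}V_s\lambda_{v(s)}$. Let $\Omega=(J_q-I_q)\otimes J_{d+1}\in\{0,1\}^{m\times m}$ and $\Delta^m_\Omega=\{\lambda\in\Delta^m:\lambda^\top\Omega\lambda=0\}$; thus $\lambda\in\Delta^m$ lies in $\Delta^m_\Omega$ exactly when only one block $\lambda_{v(s)}$ is nonzero. Problem (R1): minimize $\sum_{i\in[n]}\sum_{j\in[k]}u_{ij}\langle\lambda^j,W_i\lambda^j\rangle$ over $U=(u_{ij})\in\{0,1\}^{n\times k}$ with $Ue=e$ and $\lambda^1,\dots,\lambda^k\in\Delta^m_\Omega$, where $W_i=V^\top A_i^\top A_iV-(e\,b_i^\top A_iV+V^\top A_i^\top b_i\,e^\top)+\|b_i\|_2^2J_m$ (so $\langle\lambda,W_i\lambda\rangle=\|A_iV\lambda-b_i\|_2^2$ for $\lambda\in\Delta^m$). Separation: a set of $k$ (pairwise distinct) points $\{x_j\}_{j\in[k]}\subseteq\mathcal{P}$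 is separated by $\mathcal{P}$ if $|\{x_j\}_{j\in[k]}\cap P_s|\le1$ for all $s\in[q]$. The triangulation $\mathcal{P}$ is separating (for (C)) if an optimal set of centroids for (C) is separated by $\mathcal{P}$. *)

theory Defs
  imports "HOL-Analysis.Analysis"
begin

text \<open>
  Conventions. The index sets \<open>[n]\<close>, \<open>[k]\<close>, \<open>[q]\<close> and the dimensions \<open>d\<close>, \<open>l\<close> are finite types.
  The \<open>d + 1\<close> vertices of a simplex in \<open>real^'d\<close> are indexed by \<open>'d option\<close>, and the \<open>m = q (d + 1)\<close>
  coordinates by \<open>'q \<times> 'd option\<close>: the block \<open>v(s)\<close> consists of the indices with first component \<open>s\<close>.
  The constant \<open>1\<close> of type \<open>real^'n\<close> is the all-ones vector; the identity matrix is \<open>mat 1\<close>.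
\<close>

definition ones_mat :: "real^'n^'m" where
  "ones_mat = (\<chi> i j. 1)"

definition kronecker :: "real^'b^'a \<Rightarrow> real^'d^'c \<Rightarrow> real^('b \<times> 'd)^('a \<times> 'c)" where
  "kronecker A B = (\<chi> p r. A $ fst p $ fst r * B $ snd p $ snd r)"

definition std_simplex :: "(real^'m) set" where
  "std_simplex = {l. 0 \<le> l \<and> l \<bullet> 1 = 1}"


subsection \<open>The clustering problem (C)\<close>

definition assignment :: "real^'k^'n \<Rightarrow> bool" where
  "assignment U \<longleftrightarrow> (\<forall>i j. U $ i $ j \<in> {0, 1}) \<and> U *v 1 = 1"

definition cost_C ::
  "('n::finite \<Rightarrow> real^'d^'l) \<Rightarrow> ('n \<Rightarrow> real^'l) \<Rightarrow> ('k::finite \<Rightarrow> real^'d) \<Rightarrow> real^'k^'n \<Rightarrow> real" where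
  "cost_C A b x U = (\<Sum>i\<in>UNIV. \<Sum>j\<in>UNIV. U $ i $ j * (norm (A i *v x j - b i))\<^sup>2)"

definition optimal_C ::
  "('n::finite \<Rightarrow> real^'d^'l) \<Rightarrow> ('n \<Rightarrow> real^'l) \<Rightarrow> ('k::finite \<Rightarrow> real^'d) \<Rightarrow> real^'k^'n \<Rightarrow> bool" where
  "optimal_C A b x U \<longleftrightarrow>
     assignment U \<and> (\<forall>(x' :: 'k \<Rightarrow> real^'d) (U' :: real^'k^'n).
        assignment U' \<longrightarrow> cost_C A b x U \<le> cost_C A b x' U')"

definition optimal_centroids ::
  "('n::finite \<Rightarrow> real^'d^'l) \<Rightarrow> ('n \<Rightarrow> real^'l) \<Rightarrow> ('k::finite \<Rightarrow> real^'d) \<Rightarrow> bool" where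
  "optimal_centroids A b x \<longleftrightarrow> (\<exists>U. optimal_C A b x U)"


subsection \<open>Triangulations\<close>

text \<open>Unlike the library's \<open>triangulation\<close>, the simplices are full-dimensional and need not meet in common
  faces; only their interiors are disjoint.\<close>

definition interior_disjoint_triangulation :: "('q::finite \<Rightarrow> (real^'d) set) \<Rightarrow> bool" where
  "interior_disjoint_triangulation P \<longleftrightarrow>
     (\<forall>s. int CARD('d) simplex P s) \<and>
     (\<forall>s t. s \<noteq> t \<longrightarrow> interior (P s) \<inter> interior (P t) = {})"

text \<open>A \<open>d\<close>-simplex has exactly \<open>d + 1\<close> vertices (extreme points), so each is a column exactly once.\<close>

definition vertex_matrix :: "(real^'d) set \<Rightarrow> real^('d option)^'d \<Rightarrow> bool" where
  "vertex_matrix S M \<longleftrightarrow> columns M = {v. v extreme_point_of S}"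

definition concat_cols :: "('q::finite \<Rightarrow> real^'v^'d) \<Rightarrow> real^('q \<times> 'v)^'d" where
  "concat_cols Vs = (\<chi> r p. Vs (fst p) $ r $ snd p)"

text \<open>The argument of type \<open>'k itself\<close> below fixes the number of centroids of (C).\<close>

definition valid_constraint ::
  "'k::finite itself \<Rightarrow> ('n::finite \<Rightarrow> real^'d^'l) \<Rightarrow> ('n \<Rightarrow> real^'l) \<Rightarrow>
   ('q::finite \<Rightarrow> (real^'d) set) \<Rightarrow> bool" where
  "valid_constraint _ A b P \<longleftrightarrow>
     (\<exists>x :: 'k \<Rightarrow> real^'d. optimal_centroids A b x \<and> range x \<subseteq> (\<Union>s. P s))"

definition separated :: "('q::finite \<Rightarrow> (real^'d) set) \<Rightarrow> ('k::finite \<Rightarrow> real^'d) \<Rightarrow> bool" where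
  "separated P x \<longleftrightarrow>
     inj x \<and> range x \<subseteq> (\<Union>s. P s) \<and> (\<forall>s. card (range x \<inter> P s) \<le> 1)"

definition separating ::
  "'k::finite itself \<Rightarrow> ('n::finite \<Rightarrow> real^'d^'l) \<Rightarrow> ('n \<Rightarrow> real^'l) \<Rightarrow>
   ('q::finite \<Rightarrow> (real^'d) set) \<Rightarrow> bool" where
  "separating _ A b P \<longleftrightarrow>
     (\<exists>x :: 'k \<Rightarrow> real^'d. optimal_centroids A b x \<and> separated P x)"


subsection \<open>The reformulation (R1)\<close>

definition Omega :: "real^('q::finite \<times> 'v::finite)^('q \<times> 'v)" where
  "Omega = kronecker (ones_mat - mat 1) ones_mat"

definition simplex_Omega :: "(real^('q::finite \<times> 'v::finite)) set" where
  "simplex_Omega = {l \<in> std_simplex. l \<bullet> (Omega *v l) = 0}"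

definition W_mat :: "real^'d^'l \<Rightarrow> real^'l \<Rightarrow> real^'m^'d \<Rightarrow> real^'m^'m" where
  "W_mat A b V =
     transpose V ** transpose A ** A ** V
     - (columnvector 1 ** (rowvector b :: real^'l^1) ** A ** V
        + transpose V ** transpose A ** columnvector b ** (rowvector 1 :: real^'m^1))
     + (norm b)\<^sup>2 *\<^sub>R ones_mat"

definition cost_R1 ::
  "('n::finite \<Rightarrow> real^'d^'l) \<Rightarrow> ('n \<Rightarrow> real^'l) \<Rightarrow> real^'m^'d \<Rightarrow> ('k::finite \<Rightarrow> real^'m) \<Rightarrow> real^'k^'n \<Rightarrow> real" where
  "cost_R1 A b V L U =
     (\<Sum>i\<in>UNIV. \<Sum>j\<in>UNIV. U $ i $ j * (L j \<bullet> (W_mat (A i) (b i) V *v L j)))"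

definition feasible_R1 :: "('k::finite \<Rightarrow> real^('q::finite \<times> 'v::finite)) \<Rightarrow> real^'k^'n \<Rightarrow> bool" where
  "feasible_R1 L U \<longleftrightarrow> assignment U \<and> (\<forall>j. L j \<in> simplex_Omega)"

definition optimal_R1 ::
  "('n::finite \<Rightarrow> real^'d^'l) \<Rightarrow> ('n \<Rightarrow> real^'l) \<Rightarrow> real^('q::finite \<times> 'v::finite)^'d \<Rightarrow>
   ('k::finite \<Rightarrow> real^('q \<times> 'v)) \<Rightarrow> real^'k^'n \<Rightarrow> bool" where
  "optimal_R1 A b V L U \<longleftrightarrow>
     feasible_R1 L U \<and> (\<forall>(L' :: 'k \<Rightarrow> real^('q \<times> 'v)) (U' :: real^'k^'n).
        feasible_R1 L' U' \<longrightarrow> cost_R1 A b V L U \<le> cost_R1 A b V L' U')"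

end

theory Submission
  imports Defs
begin

text \<open>
  The complementarity constraint \<open>\<lambda>\<^sup>T \<Omega> \<lambda> = 0\<close> forces a nonnegative vector to be supported on a single
  block (\<open>simplex_Omega_single_block\<close>). If \<open>\<lambda>\<close> is supported on block \<open>s\<close>, then \<open>V \<lambda>\<close> is a convex
  combination of the vertices of \<open>P\<^sub>s\<close> and hence a point of \<open>P\<^sub>s\<close>
  (\<open>concat_cols_mult_in_convex\<close>). Two vectors \<open>\<lambda>\<^sup>j\<close> on the same block would therefore put two distinct
  centroids into one simplex, so separation says that the \<open>\<lambda>\<^sup>j\<close> occupy pairwise different blocks. Their
  sum then stores them side by side: \<open>\<lambda>\<^sub>*\<close> restricted to a block is one \<open>\<lambda>\<^sup>j\<close> or zero.

  A single-block \<open>\<lambda> \<le> \<lambda>\<^sub>*\<close> is thus dominated by one \<open>\<lambda>\<^sup>j\<close>, and two comparable vectors of the standard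
  simplex coincide because they have the same total mass (\<open>std_simplex_antichain\<close>). Conversely
  \<open>\<lambda>\<^sup>j \<le> \<lambda>\<^sub>*\<close> by nonnegativity. This equivalence for vectors on pairwise different
  blocks is \<open>range_iff_le_sum_of_disjoint_blocks\<close>.
\<close>

lemma std_simplex_iff:
  "l \<in> std_simplex \<longleftrightarrow> (\<forall>p. 0 \<le> l $ p) \<and> (\<Sum>p\<in>UNIV. l $ p) = 1"
  by (simp add: std_simplex_def less_eq_vec_def inner_vec_def)

lemma std_simplex_nonneg: "l \<in> std_simplex \<Longrightarrow> 0 \<le> l $ p"
  unfolding std_simplex_iff by blast

lemma std_simplex_nonzero_coord:
  assumes "l \<in> std_simplex"
  obtains p where "l $ p \<noteq> 0"
proof -
  have "(\<Sum>p\<in>UNIV. l $ p) \<noteq> 0"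
    using assms by (simp add: std_simplex_iff)
  then show thesis
    using that by (meson sum.neutral)
qed

lemma std_simplex_antichain:
  assumes "l \<in> std_simplex" "l' \<in> std_simplex" "l \<le> l'"
  shows "l = l'"
proof -
  have "(\<Sum>p\<in>UNIV. l' $ p - l $ p) = 0"
    using assms by (simp add: std_simplex_iff sum_subtractf)
  moreover have "\<forall>p. 0 \<le> l' $ p - l $ p"
    using assms(3) by (simp add: less_eq_vec_def)
  ultimately have "\<forall>p. l' $ p - l $ p = 0"
    by (simp add: sum_nonneg_eq_0_iff)
  then show ?thesis
    by (simp add: vec_eq_iff)
qed

lemma Omega_nth: "Omega $ p $ r = (if fst p = fst r then 0 else 1)"
  by (simp add: Omega_def kronecker_def ones_mat_def mat_def)

text \<open>
  The form \<open>\<lambda>\<^sup>T \<Omega> \<lambda>\<close> is the sum of the products \<open>\<lambda>\<^sub>p \<lambda>\<^sub>r\<close> over pairs of indices in different blocks. All of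
  them are nonnegative, so each of them vanishes, and one nonzero coordinate rules out all other blocks.
\<close>

lemma simplex_Omega_single_block:
  fixes l :: "real^('q::finite \<times> 'v::finite)"
  assumes "l \<in> simplex_Omega"
  obtains s where "\<And>p. l $ p \<noteq> 0 \<Longrightarrow> fst p = s"
proof -
  have simplex: "l \<in> std_simplex"
    using assms by (simp add: simplex_Omega_def)
  then have nonneg: "0 \<le> l $ p" for p
    by (rule std_simplex_nonneg)
  obtain p where p: "l $ p \<noteq> 0"
    using simplex by (rule std_simplex_nonzero_coord)
  have terms_nonneg: "0 \<le> l $ p * (Omega $ p $ r * l $ r)" for p r
    by (simp add: Omega_nth nonneg)
  have "(\<Sum>p\<in>UNIV. \<Sum>r\<in>UNIV. l $ p * (Omega $ p $ r * l $ r)) = 0"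
    using assms
    by (simp add: simplex_Omega_def inner_vec_def matrix_vector_mult_def sum_distrib_left)
  then have "\<forall>p\<in>UNIV. (\<Sum>r\<in>UNIV. l $ p * (Omega $ p $ r * l $ r)) = 0"
    by (subst (asm) sum_nonneg_eq_0_iff) (auto intro!: sum_nonneg terms_nonneg)
  then have "(\<Sum>r\<in>UNIV. l $ p * (Omega $ p $ r * l $ r)) = 0"
    by blast
  then have "\<forall>r\<in>UNIV. l $ p * (Omega $ p $ r * l $ r) = 0"
    by (subst (asm) sum_nonneg_eq_0_iff) (auto intro!: terms_nonneg)
  then have vanish: "l $ p * (Omega $ p $ r * l $ r) = 0" for r
    by blast
  have "fst r = fst p" if "l $ r \<noteq> 0" for r
    using vanish[of r] p that by (simp add: Omega_nth split: if_splits)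
  then show thesis
    by (rule that)
qed

lemma concat_cols_mult:
  "concat_cols Vs *v l = (\<Sum>p\<in>UNIV. l $ p *\<^sub>R column (snd p) (Vs (fst p)))"
  by (simp add: vec_eq_iff matrix_vector_mult_def concat_cols_def column_def mult.commute)

lemma concat_cols_mult_in_convex:
  fixes l :: "real^('q::finite \<times> 'v::finite)"
  assumes "l \<in> std_simplex" and block: "\<And>p. l $ p \<noteq> 0 \<Longrightarrow> fst p = s"
    and "columns (Vs s) \<subseteq> C" "convex C"
  shows "concat_cols Vs *v l \<in> C"
proof -
  let ?B = "{p. fst p = s}"
  have off_block: "l $ p = 0" if "p \<in> UNIV - ?B" for p
    using block[of p] that by blast
  have "concat_cols Vs *v l = (\<Sum>p\<in>?B. l $ p *\<^sub>R column (snd p) (Vs (fst p)))"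
    unfolding concat_cols_mult by (rule sum.mono_neutral_right) (auto simp: off_block)
  also have "\<dots> \<in> C"
  proof (rule convex_sum)
    have "(\<Sum>p\<in>?B. l $ p) = (\<Sum>p\<in>UNIV. l $ p)"
      by (rule sum.mono_neutral_left) (auto simp: off_block)
    then show "(\<Sum>p\<in>?B. l $ p) = 1"
      using assms(1) by (simp add: std_simplex_iff)
    show "column (snd p) (Vs (fst p)) \<in> C" if "p \<in> ?B" for p
      using that assms(3) by (auto simp: columns_def)
  qed (use assms in \<open>auto simp: std_simplex_iff\<close>)
  finally show ?thesis .
qed

lemma convex_if_simplex: "n simplex S \<Longrightarrow> convex S"
  by (auto simp: simplex_def)

text \<open>
  On the block of \<open>L j\<close> no other \<open>L i\<close> contributes to the sum, so there an upper bound by the sum is an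
  upper bound by \<open>L j\<close>. Since \<open>l\<close> has a positive coordinate, the sum is positive there, so the block
  \<open>t\<close> of \<open>l\<close> is that of some \<open>L j\<close>; outside this block \<open>l\<close> vanishes.
\<close>

lemma range_iff_le_sum_of_disjoint_blocks:
  fixes L :: "'k::finite \<Rightarrow> real^('q::finite \<times> 'v::finite)"
  assumes simplex: "\<And>j. L j \<in> std_simplex"
    and block: "\<And>j p. L j $ p \<noteq> 0 \<Longrightarrow> fst p = s j"
    and "inj s"
    and l: "l \<in> std_simplex" and l_block: "\<And>p. l $ p \<noteq> 0 \<Longrightarrow> fst p = t"
  shows "l \<in> range L \<longleftrightarrow> l \<le> (\<Sum>j\<in>UNIV. L j)"
proof
  assume "l \<in> range L"
  then show "l \<le> (\<Sum>j\<in>UNIV. L j)"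
    using simplex by (auto simp: less_eq_vec_def std_simplex_iff intro!: member_le_sum)
next
  assume le: "l \<le> (\<Sum>j\<in>UNIV. L j)"
  have le_at: "l $ p \<le> (\<Sum>j\<in>UNIV. L j $ p)" for p
    using le by (cases p) (simp add: less_eq_vec_def)
  have l_nonneg: "0 \<le> l $ p" for p
    using l by (rule std_simplex_nonneg)
  obtain p where p: "l $ p \<noteq> 0"
    using l by (rule std_simplex_nonzero_coord)
  then have "0 < l $ p"
    using l_nonneg[of p] by simp
  also have "l $ p \<le> (\<Sum>j\<in>UNIV. L j $ p)"
    by (rule le_at)
  finally obtain j where "L j $ p \<noteq> 0"
    by fastforce
  then have t: "t = s j"
    using block[of j p] l_block[OF p] by simp
  have "l $ r \<le> L j $ r" for r
  proof (cases "l $ r = 0")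
    case True
    then show ?thesis
      using simplex by (simp add: std_simplex_nonneg)
  next
    case False
    then have "fst r = s j"
      using l_block t by simp
    then have "L i $ r = 0" if "i \<noteq> j" for i
      using block[of i r] injD[OF \<open>inj s\<close>, of i j] that by argo
    then have "(\<Sum>i\<in>UNIV. L i $ r) = (\<Sum>i\<in>{j}. L i $ r)"
      by (intro sum.mono_neutral_right) auto
    then show ?thesis
      using le_at[of r] by simp
  qed
  then have "l = L j"
    using std_simplex_antichain[OF l simplex] by (simp add: less_eq_vec_def)
  then show "l \<in> range L"
    by simp
qed

theorem theorem6:
  fixes A :: "'n::finite \<Rightarrow> real^'d^'l"
    and b :: "'n \<Rightarrow> real^'l"
    and P :: "'q::finite \<Rightarrow> (real^'d) set"
    and Vs :: "'q \<Rightarrow> real^('d option)^'d"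
    and L :: "'k::finite \<Rightarrow> real^('q \<times> 'd option)"
    and l l_star :: "real^('q \<times> 'd option)"
  assumes "interior_disjoint_triangulation P"
    and "valid_constraint TYPE('k) A b P"
    and "\<And>s. vertex_matrix (P s) (Vs s)"
    and "separating TYPE('k) A b P"
    and "\<exists>U. optimal_R1 A b (concat_cols Vs) L U"
    and "separated P (\<lambda>j. concat_cols Vs *v L j)"
    and "l_star = (\<Sum>j\<in>UNIV. L j)"
    and "l \<in> simplex_Omega"
  shows "l \<in> range L \<longleftrightarrow> l \<le> l_star"
proof -
  obtain U where "optimal_R1 A b (concat_cols Vs) L U"
    using assms(5) by blast
  then have L: "L j \<in> simplex_Omega" for j
    by (simp add: optimal_R1_def feasible_R1_def)
  then have L_simplex: "L j \<in> std_simplex" for j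
    by (simp add: simplex_Omega_def)
  have "\<exists>s. \<forall>p. L j $ p \<noteq> 0 \<longrightarrow> fst p = s" for j
    by (rule simplex_Omega_single_block[OF L[of j]]) blast
  then have "\<exists>s. \<forall>j p. L j $ p \<noteq> 0 \<longrightarrow> fst p = s j"
    by (intro choice allI)
  then obtain s where s: "\<And>j p. L j $ p \<noteq> 0 \<Longrightarrow> fst p = s j"
    by blast
  let ?x = "\<lambda>j. concat_cols Vs *v L j"
  have in_P: "?x j \<in> P (s j)" for j
  proof (rule concat_cols_mult_in_convex[OF L_simplex s])
    show "columns (Vs (s j)) \<subseteq> P (s j)"
      using assms(3)[of "s j"] by (auto simp: vertex_matrix_def extreme_point_of_def)
    show "convex (P (s j))"
      using assms(1) convex_if_simplex
      by (auto simp: interior_disjoint_triangulation_def)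
  qed
  have "inj s"
  proof (rule injI)
    fix i j
    assume "s i = s j"
    then have "{?x i, ?x j} \<subseteq> range ?x \<inter> P (s i)"
      using in_P[of i] in_P[of j] by auto
    moreover have "card (range ?x \<inter> P (s i)) \<le> 1"
      using assms(6) by (simp add: separated_def)
    ultimately have "card {?x i, ?x j} \<le> 1"
      by (meson card_mono finite finite_Int finite_imageI le_trans)
    then have "?x i = ?x j"
      by (cases "?x i = ?x j") auto
    then show "i = j"
      using assms(6) by (auto simp: separated_def dest: injD)
  qed
  obtain t where t: "\<And>p. l $ p \<noteq> 0 \<Longrightarrow> fst p = t"
    using assms(8) by (rule simplex_Omega_single_block) (rule that)
  have "l \<in> std_simplex"
    using assms(8) by (simp add: simplex_Omega_def)
  then show ?thesis
    unfolding assms(7)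
    using range_iff_le_sum_of_disjoint_blocks[OF L_simplex s \<open>inj s\<close> _ t] by simp
qed

end
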